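(* Let $\mathcal{N}$ be a von Neumann algebra with no type $I_2$ summand, and let $(\hat U_{-t})_{t\in\mathbb{R}}$ be a one-parameter group of unitaries in $\mathcal{N}$, induced by a self-adjoint operator $\hat H$ affiliated with $\mathcal{N}$ such that $\hat U_{-t}=e^{-it\hat H}$. Let $(\tilde F_{\hat H}^{-1}(t))_{t\in\mathbb{R}}$ be the flow on $\mathrm{Sub}_{\mathrm{cl}}\underline{\Sigma}^{\mathcal{N}}$ given by $$\tilde F_{\hat H}^{-1}(t)=\underline{\tilde\phi}_{\hat U_{-t}}^{-1}=\underline{\tilde\phi}_{\hat U_t}$$ for all $t\in\mathbb{R}$. Let $\hat P_0\in\mathcal{P}(\mathcal{N})$ be a projection (representing a proposition "$A\,\varepsilon\,\delta;0$"), and let $\hat P_t=\hat U_{-t}\hat P_0\hat U_t$ (the projection representing the proposition "$A\,\varepsilon\,\delta;t$" at time $t$). Let $\underline{\delta^o}(\hat P_0),\underline{\delta^o}(\hat P_t)\in\mathrm{Sub}_{\mathrm{cl}}\underline{\Sigma}^{\mathcal{N}}$ be the outer daseinisations of $\hat P_0$ and $\hat P_t$. Then, for all $t\in\mathbb{R}$, $$\tilde F_{\hat H}^{-1}(t)(\underline{\delta^o}(\hat P_0))=\underline{\delta^o}(\hat P_t).$$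
   Context: $\mathcal{V}(\mathcal{N})$ is the context category of $\mathcal{N}$: the poset, under inclusion, of non-trivial abelian von Neumann subalgebras of $\mathcal{N}$ sharing the unit element with $\mathcal{N}$. The spectral presheaf $\underline{\Sigma}^{\mathcal{N}}$ over $\mathcal{V}(\mathcal{N})$ has components $\underline{\Sigma}^{\mathcal{N}}_V$ = Gelfand spectrum of $V$, with restriction maps $\lambda\mapsto\lambda|_{V'}$ for $V'\subseteq V$. A clopen subobject $\underline{S}$ is a family $(\underline{S}_V)_{V\in\mathcal{V}(\mathcal{N})}$ of clopen subsets $\underline{S}_V\subseteq\underline{\Sigma}^{\mathcal{N}}_V$ with $\{\lambda|_{V'}:\lambda\in\underline{S}_V\}\subseteq\underline{S}_{V'}$ for all $V'\subseteq V$; the set of these, ordered by componentwise inclusion, is $\mathrm{Sub}_{\mathrm{cl}}\underline{\Sigma}^{\mathcal{N}}$. $\mathcal{P}(\mathcal{N})$ and $\mathcal{P}(V)$ are the projection lattices of $\mathcal{N}$ and $V$. For $\hat P\in\mathcal{P}(\mathcal{N})$ and $V\in\mathcal{V}(\mathcal{N})$ let $\delta^o_V(\hat P):=\bigwedge\{\hat Q\in\mathcal{P}(V)\mid\hat Q\geq\hat P\}$. The outer daseinisation of $\hat P$ is the clopen subobject $\underline{\delta^o}(\hat P)$ with components $\{\lambda\in\underline{\Sigma}^{\mathcal{N}}_V\mid\lambda(\delta^o_V(\hat P))=1\}$, $V\in\mathcal{V}(\mathcal{N})$. A proposition "$A\,\varepsilon\,\delta;t$" says that at time $t$ the physical quantity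 $A$, represented by a self-adjoint operator $\hat A\in\mathcal{N}$, has a value in the Borel set $\delta\subseteq\mathbb{R}$; it is represented by a projection in $\mathcal{N}$ via the spectral theorem. For a unitary $\hat U\in\mathcal{N}$, $\phi_{\hat U}:\mathcal{N}\to\mathcal{N}$ is $\hat A\mapsto\hat U\hat A\hat U^*$, and $\underline{\tilde\phi}_{\hat U}:\mathrm{Sub}_{\mathrm{cl}}\underline{\Sigma}^{\mathcal{N}}\to\mathrm{Sub}_{\mathrm{cl}}\underline{\Sigma}^{\mathcal{N}}$ is the order-automorphism given by $(\underline{\tilde\phi}_{\hat U}(\underline{S}))_V=\{\lambda\circ\phi_{\hat U}|_V:\lambda\in\underline{S}_{\hat UV\hat U^*}\}$, with inverse $\underline{\tilde\phi}_{\hat U^*}$. Here $\hat U_t=e^{it\hat H}$, with $\hat H$ possibly unbounded. *)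

theory Defs
  imports "HOL-Analysis.Analysis"
begin

section \<open>Complex Hilbert spaces\<close>

class scaleC =
  fixes scaleC :: "complex \<Rightarrow> 'a \<Rightarrow> 'a"  (infixr "*\<^sub>C" 75)

text \<open>The inner product is antilinear in the first and linear in the second argument.
  No separability is assumed. Positive definiteness of the inner product follows from
  the last axiom, because \<open>norm x \<ge> 0\<close> and \<open>sqrt\<close> is negative on negative reals.\<close>

class complex_hilbert_space = banach + scaleC +
  fixes cinner :: "'a \<Rightarrow> 'a \<Rightarrow> complex"
  assumes scaleC_scaleR: "of_real r *\<^sub>C x = r *\<^sub>R x"
    and scaleC_add_right: "c *\<^sub>C (x + y) = c *\<^sub>C x + c *\<^sub>C y"
    and scaleC_add_left: "(c + d) *\<^sub>C x = c *\<^sub>C x + d *\<^sub>C x"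
    and scaleC_scaleC: "c *\<^sub>C (d *\<^sub>C x) = (c * d) *\<^sub>C x"
    and cinner_commute: "cinner x y = cnj (cinner y x)"
    and cinner_add_right: "cinner x (y + z) = cinner x y + cinner x z"
    and cinner_scaleC_right: "cinner x (c *\<^sub>C y) = c * cinner x y"
    and norm_eq_sqrt_cinner: "norm x = sqrt (Re (cinner x x))"

lemma norm_scaleC: "norm (c *\<^sub>C x) = cmod c * norm (x::'a::complex_hilbert_space)"
proof -
  have "cinner (c *\<^sub>C x) (c *\<^sub>C x) = c * cnj (cinner x (c *\<^sub>C x))"
    by (subst cinner_scaleC_right, subst cinner_commute) simp
  also have "\<dots> = (c * cnj c) * cinner x x"
    by (subst cinner_scaleC_right) (simp add: cinner_commute[of x x, symmetric])
  also have "c * cnj c = of_real ((cmod c)\<^sup>2)"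
    by (simp only: complex_norm_square)
  finally show ?thesis
    by (simp add: norm_eq_sqrt_cinner real_sqrt_mult)
qed

lemma bounded_linear_scaleC:
  "bounded_linear (\<lambda>x::'a::complex_hilbert_space. c *\<^sub>C x)"
proof (rule bounded_linear_intro[where K = "cmod c"])
  fix x y :: 'a and r :: real
  show "c *\<^sub>C (x + y) = c *\<^sub>C x + c *\<^sub>C y"
    by (rule scaleC_add_right)
  show "c *\<^sub>C (r *\<^sub>R x) = r *\<^sub>R (c *\<^sub>C x)"
    by (simp add: scaleC_scaleR[symmetric] scaleC_scaleC mult.commute)
  show "norm (c *\<^sub>C x) \<le> norm x * cmod c"
    by (simp add: norm_scaleC)
qed

lemmas scaleC_linear_simps = bounded_linear_scaleC[THEN linear_simps(2)]
  bounded_linear_scaleC[THEN linear_simps(3)] bounded_linear_scaleC[THEN linear_simps(4)]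


section \<open>The algebra of bounded operators\<close>

typedef (overloaded) ('h::complex_hilbert_space) bop =
  "{f :: 'h \<Rightarrow> 'h. bounded_linear f \<and> (\<forall>c x. f (c *\<^sub>C x) = c *\<^sub>C f x)}"
  morphisms bop_apply Bop
  by (rule exI[of _ "\<lambda>x. x"]) (simp add: bounded_linear_ident)

setup_lifting type_definition_bop

instantiation bop :: (complex_hilbert_space) "{ring, monoid_mult, scaleC}"
begin

lift_definition zero_bop :: "'a bop" is "\<lambda>_. 0"
  by (simp add: bounded_linear_zero scaleC_linear_simps)

lift_definition one_bop :: "'a bop" is "\<lambda>x. x"
  by (simp add: bounded_linear_ident)

lift_definition plus_bop :: "'a bop \<Rightarrow> 'a bop \<Rightarrow> 'a bop" is "\<lambda>f g x. f x + g x"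
  by (simp add: bounded_linear_add scaleC_add_right)

lift_definition uminus_bop :: "'a bop \<Rightarrow> 'a bop" is "\<lambda>f x. - f x"
  by (simp add: bounded_linear_minus scaleC_linear_simps)

lift_definition minus_bop :: "'a bop \<Rightarrow> 'a bop \<Rightarrow> 'a bop" is "\<lambda>f g x. f x - g x"
  by (simp add: bounded_linear_sub scaleC_linear_simps)

lift_definition times_bop :: "'a bop \<Rightarrow> 'a bop \<Rightarrow> 'a bop" is "\<lambda>f g x. f (g x)"
  by (simp add: bounded_linear_compose)

lift_definition scaleC_bop :: "complex \<Rightarrow> 'a bop \<Rightarrow> 'a bop" is "\<lambda>c f x. c *\<^sub>C f x"
  by (simp add: bounded_linear_compose[OF bounded_linear_scaleC] scaleC_scaleC mult.commute)

instance
  by standard (transfer; auto simp: fun_eq_iff linear_simps algebra_simps)+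

end

definition adj :: "'h::complex_hilbert_space bop \<Rightarrow> 'h bop" where
  "adj A = (THE B. \<forall>x y. cinner (bop_apply A x) y = cinner x (bop_apply B y))"

definition unitary :: "'h::complex_hilbert_space bop \<Rightarrow> bool" where
  "unitary U \<longleftrightarrow> adj U * U = 1 \<and> U * adj U = 1"

definition projections :: "'h::complex_hilbert_space bop set \<Rightarrow> 'h bop set" where
  "projections M = {P \<in> M. P * P = P \<and> adj P = P}"

definition proj_le :: "'h::complex_hilbert_space bop \<Rightarrow> 'h bop \<Rightarrow> bool" where
  "proj_le P Q \<longleftrightarrow> range (bop_apply P) \<subseteq> range (bop_apply Q)"

definition proj_Meet ::
    "'h::complex_hilbert_space bop set \<Rightarrow> 'h bop set \<Rightarrow> 'h bop" where
  "proj_Meet M X = (THE R. R \<in> projections M \<and> (\<forall>Q\<in>X. proj_le R Q) \<and>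
     (\<forall>R'\<in>projections M. (\<forall>Q\<in>X. proj_le R' Q) \<longrightarrow> proj_le R' R))"


section \<open>Von Neumann algebras\<close>

definition commutant :: "'h::complex_hilbert_space bop set \<Rightarrow> 'h bop set" where
  "commutant S = {T. \<forall>A\<in>S. T * A = A * T}"

text \<open>Von Neumann algebras are concrete, and their unit is the identity operator; so any two
  of them on the same space share the unit element.\<close>

definition von_neumann_algebra :: "'h::complex_hilbert_space bop set \<Rightarrow> bool" where
  "von_neumann_algebra M \<longleftrightarrow> (\<forall>A\<in>M. adj A \<in> M) \<and> commutant (commutant M) = M"

definition abelian :: "'h::complex_hilbert_space bop set \<Rightarrow> bool" where
  "abelian M \<longleftrightarrow> (\<forall>A\<in>M. \<forall>B\<in>M. A * B = B * A)"

definition abelian_projection ::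
    "'h::complex_hilbert_space bop set \<Rightarrow> 'h bop \<Rightarrow> bool" where
  "abelian_projection M P \<longleftrightarrow> P \<in> projections M \<and> abelian ((\<lambda>A. P * A * P) ` M)"

definition mvn_equivalent ::
    "'h::complex_hilbert_space bop set \<Rightarrow> 'h bop \<Rightarrow> 'h bop \<Rightarrow> bool" where
  "mvn_equivalent M P Q \<longleftrightarrow> (\<exists>W\<in>M. adj W * W = P \<and> W * adj W = Q)"

text \<open>A summand \<open>Z M\<close>, for a central projection \<open>Z\<close>, is treated as an algebra
  with unit \<open>Z\<close> on the same Hilbert space. It is of type $I_2$ if \<open>Z\<close> is the
  sum of two orthogonal equivalent abelian projections.\<close>

definition type_I2 :: "'h::complex_hilbert_space bop set \<Rightarrow> 'h bop \<Rightarrow> bool" where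
  "type_I2 M Z \<longleftrightarrow> (\<exists>P Q. abelian_projection M P \<and> abelian_projection M Q \<and>
     mvn_equivalent M P Q \<and> P * Q = 0 \<and> P + Q = Z)"

definition has_type_I2_summand :: "'h::complex_hilbert_space bop set \<Rightarrow> bool" where
  "has_type_I2_summand M \<longleftrightarrow>
     (\<exists>Z \<in> projections M \<inter> commutant M. Z \<noteq> 0 \<and> type_I2 ((\<lambda>A. Z * A) ` M) Z)"


section \<open>Unbounded self-adjoint operators\<close>

text \<open>A possibly unbounded operator is a partial map.\<close>

definition linear_operator :: "('h::complex_hilbert_space \<rightharpoonup> 'h) \<Rightarrow> bool" where
  "linear_operator H \<longleftrightarrow> H 0 = Some 0 \<and>
     (\<forall>x y u v. H x = Some u \<longrightarrow> H y = Some v \<longrightarrow> H (x + y) = Some (u + v)) \<and>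
     (\<forall>c x u. H x = Some u \<longrightarrow> H (c *\<^sub>C x) = Some (c *\<^sub>C u))"

text \<open>\<open>THE z\<close> below is unique when the domain of \<open>H\<close> is dense.\<close>

definition adjoint_operator ::
    "('h::complex_hilbert_space \<rightharpoonup> 'h) \<Rightarrow> ('h \<rightharpoonup> 'h)" where
  "adjoint_operator H = (\<lambda>y.
     if \<exists>z. \<forall>x\<in>dom H. cinner (the (H x)) y = cinner x z
     then Some (THE z. \<forall>x\<in>dom H. cinner (the (H x)) y = cinner x z) else None)"

definition selfadjoint :: "('h::complex_hilbert_space \<rightharpoonup> 'h) \<Rightarrow> bool" where
  "selfadjoint H \<longleftrightarrow> linear_operator H \<and> closure (dom H) = UNIV \<and> adjoint_operator H = H"

text \<open>The equation of partial maps says \<open>H W = W H\<close>, domains included.\<close>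

definition affiliated ::
    "('h::complex_hilbert_space \<rightharpoonup> 'h) \<Rightarrow> 'h bop set \<Rightarrow> bool" where
  "affiliated H M \<longleftrightarrow> (\<forall>W\<in>commutant M. unitary W \<longrightarrow>
     (\<forall>x. H (bop_apply W x) = map_option (bop_apply W) (H x)))"

definition projection_valued_measure ::
    "(real set \<Rightarrow> 'h::complex_hilbert_space bop) \<Rightarrow> bool" where
  "projection_valued_measure E \<longleftrightarrow>
     (\<forall>B\<in>sets borel. E B \<in> projections UNIV) \<and> E UNIV = 1 \<and>
     (\<forall>B::nat \<Rightarrow> real set. range B \<subseteq> sets borel \<longrightarrow> disjoint_family B \<longrightarrow>
        (\<forall>x. (\<lambda>n. bop_apply (E (B n)) x) sums bop_apply (E (\<Union>n. B n)) x))"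

text \<open>The measure \<open>B \<mapsto> \<langle>x, E(B) x\<rangle>\<close>.\<close>

definition scalar_measure ::
    "(real set \<Rightarrow> 'h::complex_hilbert_space bop) \<Rightarrow> 'h \<Rightarrow> real measure" where
  "scalar_measure E x =
     measure_of UNIV (sets borel) (\<lambda>B. ennreal (Re (cinner x (bop_apply (E B) x))))"

text \<open>\<open>H = \<integral> r dE(r)\<close>, with its natural domain. By polarisation the quadratic
  form determines the operator on this domain.\<close>

definition spectral_measure_of ::
    "(real set \<Rightarrow> 'h::complex_hilbert_space bop) \<Rightarrow> ('h \<rightharpoonup> 'h) \<Rightarrow> bool" where
  "spectral_measure_of E H \<longleftrightarrow> projection_valued_measure E \<and>
     dom H = {x. integrable (scalar_measure E x) (\<lambda>r. r\<^sup>2)} \<and>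
     (\<forall>x\<in>dom H. cinner x (the (H x)) = of_real (\<integral>r. r \<partial>scalar_measure E x))"

text \<open>\<open>f(H) = \<integral> f(r) dE(r)\<close> for a bounded Borel function \<open>f\<close> and
  self-adjoint \<open>H\<close>. The spectral theorem gives existence and uniqueness.\<close>

definition functional_calculus ::
    "(real \<Rightarrow> complex) \<Rightarrow> ('h::complex_hilbert_space \<rightharpoonup> 'h) \<Rightarrow> 'h bop" where
  "functional_calculus f H = (THE T. \<exists>E. spectral_measure_of E H \<and>
     (\<forall>x. cinner x (bop_apply T x) = (\<integral>r. f r \<partial>scalar_measure E x)))"

definition one_parameter_unitary_group ::
    "'h::complex_hilbert_space bop set \<Rightarrow> (real \<Rightarrow> 'h bop) \<Rightarrow> bool" where
  "one_parameter_unitary_group M U \<longleftrightarrow> (\<forall>t. U t \<in> M \<and> unitary (U t)) \<and>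
     U 0 = 1 \<and> (\<forall>s t. U (s + t) = U s * U t)"


section \<open>The spectral presheaf and its clopen subobjects\<close>

definition contexts :: "'h::complex_hilbert_space bop set \<Rightarrow> 'h bop set set" where
  "contexts N = {V. von_neumann_algebra V \<and> abelian V \<and> V \<subseteq> N \<and> V \<noteq> range (\<lambda>c. c *\<^sub>C 1)}"

text \<open>Characters of \<open>V\<close> are extensional functions on \<open>V\<close>, so that the
  restriction maps of the presheaf are instances of \<^const>\<open>restrict\<close>.\<close>

definition characters ::
    "'h::complex_hilbert_space bop set \<Rightarrow> ('h bop \<Rightarrow> complex) set" where
  "characters V = {l \<in> extensional V.
     (\<forall>A\<in>V. \<forall>B\<in>V. l (A + B) = l A + l B) \<and> (\<forall>c. \<forall>A\<in>V. l (c *\<^sub>C A) = c * l A) \<and>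
     (\<forall>A\<in>V. \<forall>B\<in>V. l (A * B) = l A * l B) \<and> (\<exists>A\<in>V. l A \<noteq> 0)}"

definition gelfand_spectrum ::
    "'h::complex_hilbert_space bop set \<Rightarrow> ('h bop \<Rightarrow> complex) topology" where
  "gelfand_spectrum V =
     subtopology (product_topology (\<lambda>_. euclidean) V) (characters V)"

definition clopen_subobjects :: "'h::complex_hilbert_space bop set \<Rightarrow>
    ('h bop set \<Rightarrow> ('h bop \<Rightarrow> complex) set) set" where
  "clopen_subobjects N = {S \<in> extensional (contexts N).
     (\<forall>V\<in>contexts N. openin (gelfand_spectrum V) (S V) \<and> closedin (gelfand_spectrum V) (S V)) \<and>
     (\<forall>V\<in>contexts N. \<forall>V'\<in>contexts N. V' \<subseteq> V \<longrightarrow> (\<lambda>l. restrict l V') ` S V \<subseteq> S V')}"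

definition outer_dasein_at ::
    "'h::complex_hilbert_space bop set \<Rightarrow> 'h bop \<Rightarrow> 'h bop" where
  "outer_dasein_at V P = proj_Meet V {Q \<in> projections V. proj_le P Q}"

definition outer_daseinisation :: "'h::complex_hilbert_space bop set \<Rightarrow> 'h bop \<Rightarrow>
    ('h bop set \<Rightarrow> ('h bop \<Rightarrow> complex) set)" where
  "outer_daseinisation N P =
     (\<lambda>V\<in>contexts N. {l \<in> topspace (gelfand_spectrum V). l (outer_dasein_at V P) = 1})"

definition conjugation :: "'h::complex_hilbert_space bop \<Rightarrow> 'h bop \<Rightarrow> 'h bop" where
  "conjugation U A = U * A * adj U"

definition subobject_map :: "'h::complex_hilbert_space bop set \<Rightarrow> 'h bop \<Rightarrow>
    ('h bop set \<Rightarrow> ('h bop \<Rightarrow> complex) set) \<Rightarrow> ('h bop set \<Rightarrow> ('h bop \<Rightarrow> complex) set)" where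
  "subobject_map N U = (\<lambda>S\<in>clopen_subobjects N. \<lambda>V\<in>contexts N.
     (\<lambda>l. restrict (l \<circ> conjugation U) V) ` S (conjugation U ` V))"

end

theory Submission
  imports Defs
begin

text \<open>
  Conjugation by a unitary \<open>U\<close> in \<open>N\<close> is an automorphism of everything from which the
  outer daseinisation is built. It permutes the contexts, since it commutes with forming
  commutants. It preserves the order of projections, so it carries the best approximation of
  \<open>U\<^sup>* P U\<close> from above in a context \<open>V\<close> to the best approximation of \<open>P\<close> in \<open>U V U\<^sup>*\<close>
  (\<open>outer_dasein_at_conjugation\<close>). Precomposition with it is a homeomorphism from the
  spectrum of \<open>U V U\<^sup>*\<close> to that of \<open>V\<close> (\<open>homeomorphic_map_pull_back\<close>). A character \<open>l\<close> of
  \<open>U V U\<^sup>*\<close> is 1 on the approximation there exactly when its pull-back is 1 on the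
  approximation in \<open>V\<close>, and so the map of subobjects sends the daseinisation of \<open>P\<close> to that of
  \<open>U\<^sup>* P U\<close> (\<open>subobject_map_outer_daseinisation\<close>). For \<open>U = U\<^sub>t\<close> the group law gives
  \<open>U\<^sub>t\<^sup>* = U\<^sub>-\<^sub>t\<close>, which turns \<open>U\<^sup>* P U\<close> into the evolved projection and makes
  the inverse of the map for \<open>U\<^sub>-\<^sub>t\<close> the map for \<open>U\<^sub>t\<close> (\<open>inverse_subobject_map\<close>).

  Adjoints and meets of projections are introduced by definite descriptions, so the argument
  also needs that these objects exist. Both existence results rest on orthogonal
  decomposition in a Hilbert space: through the Riesz representation theorem for adjoints
  (\<open>cinner_adj\<close>), and through projections onto intersections of ranges for meets
  (\<open>proj_Meet_is_meet\<close>). Existence of the meets also makes the daseinisation an actual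
  clopen subobject (\<open>outer_daseinisation_clopen\<close>), hence a legitimate argument of the flow.
\<close>

section \<open>Geometry of complex Hilbert spaces\<close>

lemma scaleC_zero_left [simp]: "0 *\<^sub>C x = (0::'a::complex_hilbert_space)"
  using scaleC_scaleR[of 0 x] by simp

lemma scaleC_minus_one: "(-1) *\<^sub>C x = - (x::'a::complex_hilbert_space)"
  using scaleC_scaleR[of "-1" x] by simp

lemma cinner_zero_right [simp]: "cinner x (0::'a::complex_hilbert_space) = 0"
  using cinner_scaleC_right[of x 0 0] by simp

lemma cinner_minus_right: "cinner x (- y::'a::complex_hilbert_space) = - cinner x y"
  using cinner_scaleC_right[of x "-1" y] by (simp add: scaleC_minus_one)

lemma cinner_diff_right:
  "cinner x (y - z::'a::complex_hilbert_space) = cinner x y - cinner x z"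
  using cinner_add_right[of x y "- z"] by (simp add: cinner_minus_right)

lemma cinner_add_left:
  "cinner (x + y) (z::'a::complex_hilbert_space) = cinner x z + cinner y z"
  by (simp add: cinner_commute[of _ z] cinner_add_right)

lemma cinner_diff_left:
  "cinner (x - y) (z::'a::complex_hilbert_space) = cinner x z - cinner y z"
  by (simp add: cinner_commute[of _ z] cinner_diff_right)

lemma cinner_scaleC_left:
  "cinner (c *\<^sub>C x) (y::'a::complex_hilbert_space) = cnj c * cinner x y"
  by (simp add: cinner_commute[of _ y] cinner_scaleC_right)

lemma cinner_zero_left [simp]: "cinner (0::'a::complex_hilbert_space) x = 0"
  by (simp add: cinner_commute[of 0 x])

lemma norm_squared_eq_cinner: "(norm (x::'a::complex_hilbert_space))\<^sup>2 = Re (cinner x x)"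
proof -
  have "Re (cinner x x) \<ge> 0"
    using norm_ge_zero[of x] by (simp only: norm_eq_sqrt_cinner real_sqrt_ge_0_iff)
  then show ?thesis
    by (simp add: norm_eq_sqrt_cinner)
qed

lemma cinner_self: "cinner x x = of_real ((norm (x::'a::complex_hilbert_space))\<^sup>2)"
proof -
  have "Im (cinner x x) = 0"
    using arg_cong[OF cinner_commute[of x x], of Im] by simp
  then show ?thesis
    by (simp add: complex_eq_iff norm_squared_eq_cinner)
qed

lemma cinner_right_ext:
  assumes "\<And>x. cinner x y = cinner x (z::'a::complex_hilbert_space)"
  shows "y = z"
proof -
  have "cinner (y - z) (y - z) = 0"
    using assms[of "y - z"] by (simp add: cinner_diff_right)
  then show ?thesis
    by (simp add: cinner_self)
qed

lemma parallelogram_law: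
  "(norm (x + y))\<^sup>2 + (norm (x - y))\<^sup>2
     = 2 * (norm x)\<^sup>2 + 2 * (norm (y::'a::complex_hilbert_space))\<^sup>2"
  by (simp add: norm_squared_eq_cinner cinner_add_left cinner_add_right
      cinner_diff_left cinner_diff_right)

text \<open>Moving \<open>x\<close> in the direction of its component along \<open>y\<close> changes the norm by a real
  quadratic polynomial in \<open>s\<close>. A good choice of \<open>s\<close> gives the Cauchy--Schwarz inequality and
  also the orthogonality of a shortest vector.\<close>

lemma norm_squared_diff_component:
  fixes x y :: "'a::complex_hilbert_space"
  defines "c \<equiv> cinner y x"
  shows "(norm (x - (of_real s * c) *\<^sub>C y))\<^sup>2
    = (norm x)\<^sup>2 - 2 * s * (cmod c)\<^sup>2 + s\<^sup>2 * (cmod c)\<^sup>2 * (norm y)\<^sup>2"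
proof -
  have yx: "cinner x y = cnj c"
    unfolding c_def by (rule cinner_commute)
  have cc: "c * cnj c = of_real ((cmod c)\<^sup>2)"
    by (simp only: complex_norm_square)
  have "complex_of_real ((norm (x - (of_real s * c) *\<^sub>C y))\<^sup>2)
      = of_real ((norm x)\<^sup>2) - 2 * of_real s * (c * cnj c)
        + (of_real s)\<^sup>2 * (c * cnj c) * of_real ((norm y)\<^sup>2)"
    unfolding cinner_self[symmetric]
    by (simp add: cinner_diff_left cinner_diff_right cinner_scaleC_left cinner_scaleC_right
        yx c_def[symmetric] algebra_simps power2_eq_square)
  also have "\<dots> = of_real ((norm x)\<^sup>2 - 2 * s * (cmod c)\<^sup>2 + s\<^sup>2 * (cmod c)\<^sup>2 * (norm y)\<^sup>2)"
    unfolding cc by simp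
  finally show ?thesis
    by (simp only: of_real_eq_iff)
qed

lemma Cauchy_Schwarz_cinner:
  "cmod (cinner y x) \<le> norm y * norm (x::'a::complex_hilbert_space)"
proof (cases "y = 0")
  case False
  let ?c = "cmod (cinner y x)" and ?n = "(norm y)\<^sup>2"
  have n: "?n > 0"
    using False by simp
  have "0 \<le> (norm (x - (of_real (1 / ?n) * cinner y x) *\<^sub>C y))\<^sup>2"
    by simp
  also have "\<dots> = (norm x)\<^sup>2 - 2 * (1 / ?n) * ?c\<^sup>2 + (1 / ?n)\<^sup>2 * ?c\<^sup>2 * ?n"
    by (rule norm_squared_diff_component)
  also have "\<dots> = (norm x)\<^sup>2 - ?c\<^sup>2 / ?n"
    using n by (simp add: field_simps power2_eq_square)
  finally have "?c\<^sup>2 \<le> (norm y * norm x)\<^sup>2"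
    using n by (simp add: field_simps)
  then show ?thesis
    by (rule power2_le_imp_le) simp
qed simp

definition closed_csubspace :: "'a::complex_hilbert_space set \<Rightarrow> bool" where
  "closed_csubspace K \<longleftrightarrow> closed K \<and> 0 \<in> K \<and> (\<forall>x\<in>K. \<forall>y\<in>K. x + y \<in> K) \<and>
     (\<forall>c. \<forall>x\<in>K. c *\<^sub>C x \<in> K)"

lemma closed_csubspace_diff:
  assumes "closed_csubspace K" "x \<in> K" "y \<in> K"
  shows "x - y \<in> K"
proof -
  have "x + (-1) *\<^sub>C y \<in> K"
    using assms unfolding closed_csubspace_def by blast
  then show ?thesis
    by (simp add: scaleC_minus_one)
qed

lemma closed_csubspace_INT:
  assumes "\<And>i. i \<in> I \<Longrightarrow> closed_csubspace (K i)"
  shows "closed_csubspace (\<Inter>i\<in>I. K i)"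
  using assms unfolding closed_csubspace_def by (simp add: closed_INT)

text \<open>By the parallelogram law any sequence in \<open>K\<close> whose distances to \<open>x\<close> tend to the infimum
  is Cauchy, because the midpoint of two of its terms is again in \<open>K\<close> and so is not closer to
  \<open>x\<close> than the infimum.\<close>

lemma closest_point_exists:
  fixes K :: "'a::complex_hilbert_space set"
  assumes K: "closed_csubspace K"
  shows "\<exists>k\<in>K. \<forall>y\<in>K. norm (x - k) \<le> norm (x - y)"
proof -
  define d where "d = infdist x K"
  have ne: "K \<noteq> {}"
    using K by (auto simp: closed_csubspace_def)
  have d0: "d \<ge> 0"
    by (simp add: d_def infdist_nonneg)
  have lower: "d \<le> norm (x - y)" if "y \<in> K" for y
    using infdist_le[OF that, of x] by (simp add: d_def dist_norm)
  have "\<exists>y\<in>K. norm (x - y) < d + e" if "e > 0" for e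
  proof (rule ccontr)
    assume "\<not> ?thesis"
    then have "d + e \<le> dist x y" if "y \<in> K" for y
      using that by (force simp: dist_norm)
    then have "d + e \<le> infdist x K"
      unfolding infdist_notempty[OF ne] using ne by (intro cINF_greatest)
    with \<open>e > 0\<close> show False
      by (simp add: d_def)
  qed
  then have "\<forall>n. \<exists>y\<in>K. norm (x - y) < d + inverse (real (Suc n))"
    by simp
  then obtain k where k: "\<And>n. k n \<in> K" "\<And>n. norm (x - k n) < d + inverse (real (Suc n))"
    by metis
  have close: "(norm (a - b))\<^sup>2 \<le> 8 * d * e + 4 * e\<^sup>2"
    if "a \<in> K" "b \<in> K" "norm (x - a) \<le> d + e" "norm (x - b) \<le> d + e" for a b e
  proof -
    have "(1/2) *\<^sub>C (a + b) \<in> K"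
      using K that by (simp add: closed_csubspace_def)
    moreover have "(1/2) *\<^sub>C (a + b) = (1/2) *\<^sub>R (a + b)"
      using scaleC_scaleR[of "1/2" "a + b"] by simp
    ultimately have "d \<le> norm (x - (1/2) *\<^sub>R (a + b))"
      using lower by simp
    moreover have "(x - a) + (x - b) = 2 *\<^sub>R (x - (1/2) *\<^sub>R (a + b))"
      by (simp add: algebra_simps scaleR_2)
    ultimately have "2 * d \<le> norm ((x - a) + (x - b))"
      by simp
    then have "(2 * d)\<^sup>2 \<le> (norm ((x - a) + (x - b)))\<^sup>2"
      using d0 by (intro power_mono) auto
    moreover have "(norm (x - a))\<^sup>2 \<le> (d + e)\<^sup>2" "(norm (x - b))\<^sup>2 \<le> (d + e)\<^sup>2"
      using that by (auto intro!: power_mono)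
    moreover have "norm ((x - a) - (x - b)) = norm (a - b)"
      by (simp add: norm_minus_commute)
    ultimately show ?thesis
      using parallelogram_law[of "x - a" "x - b"]
      by (simp add: power2_eq_square algebra_simps)
  qed
  have lim0: "(\<lambda>n. inverse (real (Suc n))) \<longlonglongrightarrow> 0"
    by (rule LIMSEQ_inverse_real_of_nat)
  have "(\<lambda>n. 8 * d * inverse (real (Suc n)) + 4 * (inverse (real (Suc n)))\<^sup>2)
      \<longlonglongrightarrow> 8 * d * 0 + 4 * 0\<^sup>2"
    by (intro tendsto_intros lim0)
  then have lim: "(\<lambda>n. 8 * d * inverse (real (Suc n)) + 4 * (inverse (real (Suc n)))\<^sup>2) \<longlonglongrightarrow> 0"
    by simp
  have "Cauchy k"
  proof (rule metric_CauchyI)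
    fix r :: real
    assume r: "r > 0"
    then obtain M where
      "8 * d * inverse (real (Suc M)) + 4 * (inverse (real (Suc M)))\<^sup>2 < r\<^sup>2"
      using order_tendstoD(2)[OF lim, of "r\<^sup>2"] by (auto simp: eventually_sequentially)
    moreover have "norm (x - k n) \<le> d + inverse (real (Suc M))" if "n \<ge> M" for n
    proof -
      have "inverse (real (Suc n)) \<le> inverse (real (Suc M))"
        using that by (intro le_imp_inverse_le) auto
      with k(2)[of n] show ?thesis
        by linarith
    qed
    ultimately have "(norm (k m - k n))\<^sup>2 < r\<^sup>2" if "m \<ge> M" "n \<ge> M" for m n
      using that close[OF k(1) k(1)] by (meson le_less_trans)
    then have "dist (k m) (k n) < r" if "m \<ge> M" "n \<ge> M" for m n
      using that r power2_less_imp_less[of "norm (k m - k n)" r] by (simp add: dist_norm)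
    then show "\<exists>M. \<forall>m\<ge>M. \<forall>n\<ge>M. dist (k m) (k n) < r"
      by blast
  qed
  then obtain l where l: "k \<longlonglongrightarrow> l"
    using Cauchy_convergent_iff convergent_def by blast
  have "l \<in> K"
    using K k(1) l closed_sequentially unfolding closed_csubspace_def by blast
  moreover have "norm (x - l) \<le> d"
  proof (rule LIMSEQ_le)
    show "(\<lambda>n. norm (x - k n)) \<longlonglongrightarrow> norm (x - l)"
      by (intro tendsto_intros l)
    show "(\<lambda>n. d + inverse (real (Suc n))) \<longlonglongrightarrow> d"
      using tendsto_add[OF tendsto_const lim0, of d] by simp
    show "\<exists>N. \<forall>n\<ge>N. norm (x - k n) \<le> d + inverse (real (Suc n))"
      using k(2) less_imp_le by blast
  qed
  ultimately show ?thesis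
    using lower order_trans by blast
qed

text \<open>If the vector from the closest point \<open>k\<close> to \<open>x\<close> had a component along some \<open>y\<close> in
  \<open>K\<close>, moving \<open>k\<close> a little along \<open>y\<close> would bring it closer to \<open>x\<close>.\<close>

lemma orthogonal_decomposition:
  fixes K :: "'a::complex_hilbert_space set"
  assumes K: "closed_csubspace K"
  shows "\<exists>k\<in>K. \<forall>y\<in>K. cinner y (x - k) = 0"
proof -
  obtain k where k: "k \<in> K" "\<And>y. y \<in> K \<Longrightarrow> norm (x - k) \<le> norm (x - y)"
    using closest_point_exists[OF K] by blast
  have "cinner y (x - k) = 0" if y: "y \<in> K" for y
  proof (rule ccontr)
    define c where "c = cinner y (x - k)"
    assume "cinner y (x - k) \<noteq> 0"
    then have c: "(cmod c)\<^sup>2 > 0"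
      by (simp add: c_def)
    \<comment> \<open>The optimal step \<open>1 / \<parallel>y\<parallel>\<^sup>2\<close>, with the denominator kept away from 0.\<close>
    define s where "s = 1 / ((norm y)\<^sup>2 + 1)"
    have s: "s > 0" "s * (norm y)\<^sup>2 < 1"
      by (auto simp: s_def field_simps add_pos_nonneg intro: add_nonneg_pos)
    have "k + (of_real s * c) *\<^sub>C y \<in> K"
      using K k(1) y by (simp add: closed_csubspace_def)
    then have "norm (x - k) \<le> norm (x - (k + (of_real s * c) *\<^sub>C y))"
      by (rule k(2))
    then have "norm (x - k) \<le> norm ((x - k) - (of_real s * c) *\<^sub>C y)"
      by (simp add: algebra_simps)
    then have "(norm (x - k))\<^sup>2 \<le> (norm ((x - k) - (of_real s * c) *\<^sub>C y))\<^sup>2"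
      by (intro power_mono) auto
    also have "\<dots> = (norm (x - k))\<^sup>2 - 2 * s * (cmod c)\<^sup>2 + s\<^sup>2 * (cmod c)\<^sup>2 * (norm y)\<^sup>2"
      unfolding c_def by (rule norm_squared_diff_component)
    also have "\<dots> = (norm (x - k))\<^sup>2 - (s * (cmod c)\<^sup>2) * (2 - s * (norm y)\<^sup>2)"
      by (simp add: algebra_simps power2_eq_square)
    finally have "(s * (cmod c)\<^sup>2) * (2 - s * (norm y)\<^sup>2) \<le> 0"
      by simp
    moreover have "(s * (cmod c)\<^sup>2) * (2 - s * (norm y)\<^sup>2) > 0"
      using s c by (intro mult_pos_pos) auto
    ultimately show False
      by simp
  qed
  with k(1) show ?thesis
    by blast
qed

text \<open>A vector orthogonal to the kernel of a nonzero functional represents it up to a scalar,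
  since the kernel has codimension one.\<close>

lemma Riesz_representation:
  fixes f :: "'a::complex_hilbert_space \<Rightarrow> complex"
  assumes add: "\<And>x y. f (x + y) = f x + f y"
    and scale: "\<And>c x. f (c *\<^sub>C x) = c * f x"
    and cont: "continuous_on UNIV f"
  shows "\<exists>w. \<forall>x. f x = cinner w x"
proof (cases "\<forall>x. f x = 0")
  case True
  then show ?thesis
    by (intro exI[of _ 0]) simp
next
  case False
  then obtain x where x: "f x \<noteq> 0"
    by blast
  have diff: "f (u - v) = f u - f v" for u v
    using add[of "u - v" v] by simp
  define K where "K = {x. f x = 0}"
  have "closed K"
    unfolding K_def using cont by (intro closed_Collect_eq continuous_on_const)
  moreover have "f 0 = 0"
    using scale[of 0 0] by simp
  ultimately have "closed_csubspace K"
    by (simp add: closed_csubspace_def K_def add scale)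
  then obtain k where k: "k \<in> K" "\<And>y. y \<in> K \<Longrightarrow> cinner y (x - k) = 0"
    using orthogonal_decomposition by blast
  define z where "z = x - k"
  have fz: "f z \<noteq> 0"
    using k(1) x by (simp add: z_def K_def diff)
  have z0: "cinner z z \<noteq> 0"
  proof
    assume "cinner z z = 0"
    then have "z = 0"
      by (simp add: cinner_self)
    with fz \<open>f 0 = 0\<close> show False
      by simp
  qed
  have "f y = cinner (cnj (f z / cinner z z) *\<^sub>C z) y" for y
  proof -
    have "y - (f y / f z) *\<^sub>C z \<in> K"
      using fz by (simp add: K_def diff scale)
    then have "cinner (y - (f y / f z) *\<^sub>C z) z = 0"
      unfolding z_def by (rule k(2))
    then have "cinner z (y - (f y / f z) *\<^sub>C z) = 0"
      by (subst cinner_commute) simp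
    then have "cinner z y = f y / f z * cinner z z"
      by (simp add: cinner_diff_right cinner_scaleC_right)
    then show ?thesis
      using fz z0 by (simp add: cinner_scaleC_left)
  qed
  then show ?thesis
    by blast
qed


section \<open>Adjoints and projections\<close>

lemma bop_eqI: "(\<And>x. bop_apply A x = bop_apply B x) \<Longrightarrow> A = B"
  by (simp add: bop_apply_inject[symmetric] fun_eq_iff)

lemma bounded_linear_bop: "bounded_linear (bop_apply A)"
  using bop_apply[of A] by simp

lemma bop_apply_add: "bop_apply A (x + y) = bop_apply A x + bop_apply A y"
  by (rule linear_simps(1)[OF bounded_linear_bop])

lemma bop_apply_scaleC: "bop_apply A (c *\<^sub>C x) = c *\<^sub>C bop_apply A x"
  using bop_apply[of A] by simp

lemma bop_apply_zero: "bop_apply A 0 = 0"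
  by (rule linear_simps(3)[OF bounded_linear_bop])

lemma bop_apply_mult: "bop_apply (A * B) x = bop_apply A (bop_apply B x)"
  by (simp add: times_bop.rep_eq)

lemma bop_apply_one: "bop_apply 1 x = x"
  by (simp add: one_bop.rep_eq)

lemma scaleC_mult_bop: "(c *\<^sub>C A) * B = c *\<^sub>C (A * B)"
  for A B :: "'h::complex_hilbert_space bop"
  by (rule bop_eqI) (simp add: bop_apply_mult scaleC_bop.rep_eq bop_apply_scaleC)

lemma mult_scaleC_bop: "A * (c *\<^sub>C B) = c *\<^sub>C (A * B)"
  for A B :: "'h::complex_hilbert_space bop"
  by (rule bop_eqI) (simp add: bop_apply_mult scaleC_bop.rep_eq bop_apply_scaleC)

lemma bop_apply_Bop:
  assumes "\<And>x y. f (x + y) = f x + f y" "\<And>c x. f (c *\<^sub>C x) = c *\<^sub>C f x"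
    and "\<And>x. norm (f x) \<le> norm x * B"
  shows "bop_apply (Bop f) = f"
proof (rule Bop_inverse)
  have "bounded_linear f"
    using assms by (intro bounded_linear_intro[where K = B]) (auto simp: scaleC_scaleR[symmetric])
  with assms(2) show "f \<in> {f. bounded_linear f \<and> (\<forall>c x. f (c *\<^sub>C x) = c *\<^sub>C f x)}"
    by simp
qed

lemma adjI:
  assumes "\<And>x y. cinner (bop_apply A x) y = cinner x (bop_apply B y)"
  shows "adj A = B"
  unfolding adj_def
proof (rule the_equality)
  fix C
  assume "\<forall>x y. cinner (bop_apply A x) y = cinner x (bop_apply C y)"
  with assms show "C = B"
    by (intro bop_eqI cinner_right_ext) metis
qed (use assms in simp)

text \<open>For fixed \<open>y\<close> the functional \<open>x \<mapsto> \<langle>y, A x\<rangle>\<close> is represented by a vector \<open>B y\<close>. The map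
  \<open>B\<close> is bounded because \<open>\<parallel>B y\<parallel>\<^sup>2 = \<langle>A (B y), y\<rangle> \<le> \<parallel>A\<parallel> \<parallel>B y\<parallel> \<parallel>y\<parallel>\<close>.\<close>

lemma cinner_adj: "cinner (bop_apply A x) y = cinner x (bop_apply (adj A) y)"
proof -
  have "\<exists>w. \<forall>x. cinner y (bop_apply A x) = cinner w x" for y
  proof (rule Riesz_representation)
    have "bounded_linear (cinner y)"
    proof (rule bounded_linear_intro[where K = "norm y"])
      show "cinner y (u + v) = cinner y u + cinner y v" for u v
        by (rule cinner_add_right)
      show "cinner y (r *\<^sub>R u) = r *\<^sub>R cinner y u" for r u
        by (simp add: scaleC_scaleR[symmetric] cinner_scaleC_right scaleR_conv_of_real)
      show "norm (cinner y u) \<le> norm u * norm y" for u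
        using Cauchy_Schwarz_cinner[of y u] by (simp add: mult.commute)
    qed
    then show "continuous_on UNIV (\<lambda>x. cinner y (bop_apply A x))"
      by (intro linear_continuous_on bounded_linear_compose[OF _ bounded_linear_bop])
  qed (auto simp: bop_apply_add bop_apply_scaleC cinner_add_right cinner_scaleC_right)
  then obtain B where B: "\<And>x y. cinner y (bop_apply A x) = cinner (B y) x"
    by metis
  then have eq: "cinner (bop_apply A x) y = cinner x (B y)" for x y
    by (metis cinner_commute)
  obtain C where C: "C \<ge> 0" "\<And>x. norm (bop_apply A x) \<le> norm x * C"
    using bounded_linear.nonneg_bounded[OF bounded_linear_bop] by blast
  have "bop_apply (Bop B) = B"
  proof (rule bop_apply_Bop)
    show "B (x + y) = B x + B y" for x y
      by (rule cinner_right_ext) (simp add: eq[symmetric] cinner_add_right)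
    show "B (c *\<^sub>C x) = c *\<^sub>C B x" for c x
      by (rule cinner_right_ext) (simp add: eq[symmetric] cinner_scaleC_right)
    show "norm (B y) \<le> norm y * C" for y
    proof (cases "B y = 0")
      case False
      have "(norm (B y))\<^sup>2 = cmod (cinner (B y) (B y))"
        by (simp add: cinner_self norm_power)
      also have "\<dots> \<le> norm (bop_apply A (B y)) * norm y"
        unfolding eq[symmetric] by (rule Cauchy_Schwarz_cinner)
      also have "\<dots> \<le> (norm (B y) * C) * norm y"
        by (intro mult_right_mono C) auto
      finally show ?thesis
        using False by (simp add: power2_eq_square mult.assoc) (simp add: mult.commute)
    qed (use C in simp)
  qed
  with eq have "adj A = Bop B"
    by (intro adjI) simp
  with eq \<open>bop_apply (Bop B) = B\<close> show ?thesis
    by simp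
qed

lemma cinner_adj': "cinner (bop_apply (adj A) x) y = cinner x (bop_apply A y)"
  by (metis cinner_adj cinner_commute)

lemma adj_adj [simp]: "adj (adj A) = A"
  by (rule adjI) (rule cinner_adj')

lemma adj_mult: "adj (A * B) = adj B * adj A"
  by (rule adjI) (simp add: bop_apply_mult cinner_adj)

lemma range_idempotent:
  assumes "P * P = P"
  shows "range (bop_apply P) = {x. bop_apply P x = x}"
proof -
  have "bop_apply P (bop_apply P x) = bop_apply P x" for x
    by (simp add: bop_apply_mult[symmetric] assms)
  then have "x \<in> range (bop_apply P) \<longleftrightarrow> bop_apply P x = x" for x
    by (metis rangeE rangeI)
  then show ?thesis
    by blast
qed

lemma closed_csubspace_range_idempotent:
  assumes "P * P = P"
  shows "closed_csubspace (range (bop_apply P))"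
proof -
  have "closed {x. bop_apply P x = x}"
    by (intro closed_Collect_eq linear_continuous_on bounded_linear_bop continuous_on_id)
  then show ?thesis
    unfolding range_idempotent[OF assms] closed_csubspace_def
    by (simp add: bop_apply_add bop_apply_scaleC bop_apply_zero)
qed

text \<open>Uniqueness of the decomposition makes its component in \<open>K\<close> linear in \<open>x\<close>. It is also
  self-adjoint, since \<open>\<langle>r x, y\<rangle> = \<langle>r x, r y\<rangle>\<close> is symmetric under exchanging \<open>x\<close> and \<open>y\<close>.\<close>

lemma orthogonal_projection_exists:
  fixes K :: "'h::complex_hilbert_space set"
  assumes K: "closed_csubspace K"
  shows "\<exists>R. R * R = R \<and> adj R = R \<and> range (bop_apply R) = K"
proof -
  obtain r where r: "\<And>x. r x \<in> K" "\<And>x y. y \<in> K \<Longrightarrow> cinner y (x - r x) = 0"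
    using orthogonal_decomposition[OF K] by metis
  have unique: "r x = k" if k: "k \<in> K" "\<And>y. y \<in> K \<Longrightarrow> cinner y (x - k) = 0" for x k
  proof -
    have m: "r x - k \<in> K"
      using closed_csubspace_diff[OF K] r(1) k(1) .
    have "cinner (r x - k) (r x - k) = cinner (r x - k) (x - k) - cinner (r x - k) (x - r x)"
      by (simp add: cinner_diff_right)
    also have "\<dots> = 0"
      using k(2)[OF m] r(2)[OF m] by simp
    finally show ?thesis
      by (simp add: cinner_self)
  qed
  have fixed: "r x = x" if "x \<in> K" for x
    using that by (intro unique) auto
  have inner: "cinner (r x) y = cinner (r x) (r y)" for x y
    using r(2)[OF r(1)[of x], of y] by (simp add: cinner_diff_right)
  have app: "bop_apply (Bop r) = r"
  proof (rule bop_apply_Bop)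
    show "r (x + y) = r x + r y" for x y
    proof (rule unique)
      show "r x + r y \<in> K"
        using K r(1) by (simp add: closed_csubspace_def)
      show "cinner z (x + y - (r x + r y)) = 0" if "z \<in> K" for z
        using r(2)[OF that, of x] r(2)[OF that, of y]
        by (simp add: cinner_diff_right cinner_add_right)
    qed
    show "r (c *\<^sub>C x) = c *\<^sub>C r x" for c x
    proof (rule unique)
      show "c *\<^sub>C r x \<in> K"
        using K r(1) by (simp add: closed_csubspace_def)
      show "cinner z (c *\<^sub>C x - c *\<^sub>C r x) = 0" if "z \<in> K" for z
        using r(2)[OF that, of x] by (simp add: cinner_diff_right cinner_scaleC_right)
    qed
    show "norm (r x) \<le> norm x * 1" for x
    proof (cases "r x = 0")
      case False
      have "(norm (r x))\<^sup>2 = cmod (cinner (r x) (r x))"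
        by (simp add: cinner_self norm_power)
      also have "\<dots> \<le> norm (r x) * norm x"
        unfolding inner[symmetric] by (rule Cauchy_Schwarz_cinner)
      finally show ?thesis
        using False by (simp add: power2_eq_square)
    qed simp
  qed
  have "Bop r * Bop r = Bop r"
    by (rule bop_eqI) (simp add: bop_apply_mult app fixed r(1))
  moreover have "adj (Bop r) = Bop r"
  proof (rule adjI)
    fix x y
    have "cinner x (r y) = cnj (cinner (r y) (r x))"
      using cinner_commute[of x "r y"] by (simp only: inner[of y x])
    then show "cinner (bop_apply (Bop r) x) y = cinner x (bop_apply (Bop r) y)"
      unfolding app using inner[of x y] cinner_commute[of "r x" "r y"] by simp
  qed
  moreover have "range r = K"
    using r(1) fixed by (metis image_subset_iff rangeI subset_antisym subsetI)
  ultimately show ?thesis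
    using app by auto
qed

lemma projectionsD:
  assumes "P \<in> projections M"
  shows "P \<in> M" "P * P = P" "adj P = P"
  using assms by (auto simp: projections_def)

lemma proj_le_iff_mult:
  assumes "Q * Q = Q"
  shows "proj_le P Q \<longleftrightarrow> Q * P = P"
proof -
  have "proj_le P Q \<longleftrightarrow> (\<forall>x. bop_apply (Q * P) x = bop_apply P x)"
    unfolding proj_le_def range_idempotent[OF assms] by (auto simp: bop_apply_mult)
  also have "\<dots> \<longleftrightarrow> Q * P = P"
    by (auto intro: bop_eqI)
  finally show ?thesis .
qed

lemma proj_le_antisym:
  assumes "P \<in> projections M" "Q \<in> projections M" "proj_le P Q" "proj_le Q P"
  shows "P = Q"
proof -
  have "Q * P = P" "P * Q = Q"
    using assms by (simp_all add: proj_le_iff_mult projectionsD)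
  then have "P = adj (Q * P)"
    using assms(1) by (simp add: projectionsD)
  also have "\<dots> = P * Q"
    using assms(1,2) by (simp only: adj_mult projectionsD)
  finally show ?thesis
    using \<open>P * Q = Q\<close> by simp
qed

lemma proj_Meet_eqI:
  assumes "R \<in> projections M" "\<And>Q. Q \<in> X \<Longrightarrow> proj_le R Q"
    and "\<And>R'. R' \<in> projections M \<Longrightarrow> \<forall>Q\<in>X. proj_le R' Q \<Longrightarrow> proj_le R' R"
  shows "proj_Meet M X = R"
  unfolding proj_Meet_def
  using assms by (intro the_equality) (auto intro!: proj_le_antisym[of _ M])


section \<open>Completeness of the projection lattice\<close>

lemma commutant_adj:
  assumes "\<And>A. A \<in> V \<Longrightarrow> adj A \<in> V" "T \<in> commutant V"
  shows "adj T \<in> commutant V"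
proof -
  have "adj T * A = A * adj T" if "A \<in> V" for A
  proof -
    have "T * adj A = adj A * T"
      using assms that by (simp add: commutant_def)
    then have "adj (T * adj A) = adj (adj A * T)"
      by simp
    then show ?thesis
      by (simp add: adj_mult)
  qed
  then show ?thesis
    by (simp add: commutant_def)
qed

lemma von_neumann_algebra_closed:
  assumes "von_neumann_algebra V"
  shows "1 \<in> V" and "A \<in> V \<Longrightarrow> adj A \<in> V" and "A \<in> V \<Longrightarrow> c *\<^sub>C A \<in> V"
    and "A \<in> V \<Longrightarrow> B \<in> V \<Longrightarrow> A + B \<in> V" and "A \<in> V \<Longrightarrow> B \<in> V \<Longrightarrow> A * B \<in> V"
proof -
  have V: "V = commutant (commutant V)"
    using assms by (simp add: von_neumann_algebra_def)
  have mult: "A * B \<in> commutant S" if "A \<in> commutant S" "B \<in> commutant S" for A B and S :: "'a bop set"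
  proof -
    have "A * B * C = C * (A * B)" if "C \<in> S" for C
      using that \<open>A \<in> commutant S\<close> \<open>B \<in> commutant S\<close>
      unfolding commutant_def by (metis (mono_tags, lifting) mem_Collect_eq mult.assoc)
    then show ?thesis
      by (simp add: commutant_def)
  qed
  show "1 \<in> V"
    by (subst V) (simp add: commutant_def)
  show "A \<in> V \<Longrightarrow> adj A \<in> V"
    using assms by (simp add: von_neumann_algebra_def)
  show "A \<in> V \<Longrightarrow> c *\<^sub>C A \<in> V"
    by (subst (asm) V, subst V) (simp add: commutant_def scaleC_mult_bop mult_scaleC_bop)
  show "A \<in> V \<Longrightarrow> B \<in> V \<Longrightarrow> A + B \<in> V"
    by (subst (asm) (1 2) V, subst V) (simp add: commutant_def algebra_simps)
  show "A \<in> V \<Longrightarrow> B \<in> V \<Longrightarrow> A * B \<in> V"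
    using mult[of A "commutant V" B] V by simp
qed

text \<open>If \<open>T\<close> and \<open>T\<^sup>*\<close> preserve the range of \<open>R\<close>, then \<open>R T R = T R\<close> and
  \<open>R T\<^sup>* R = T\<^sup>* R\<close>. The adjoint of the second equation is \<open>R T R = R T\<close>.\<close>

lemma projection_commutes_if_range_invariant:
  assumes R: "R * R = R" "adj R = R"
    and T: "\<And>x. x \<in> range (bop_apply R) \<Longrightarrow> bop_apply T x \<in> range (bop_apply R)"
    and T': "\<And>x. x \<in> range (bop_apply R) \<Longrightarrow> bop_apply (adj T) x \<in> range (bop_apply R)"
  shows "R * T = T * R"
proof -
  have "R * (S * R) = S * R"
    if "\<And>x. x \<in> range (bop_apply R) \<Longrightarrow> bop_apply S x \<in> range (bop_apply R)" for S
  proof (rule bop_eqI)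
    fix x
    have "bop_apply S (bop_apply R x) \<in> range (bop_apply R)"
      using that by blast
    then show "bop_apply (R * (S * R)) x = bop_apply (S * R) x"
      by (simp add: range_idempotent[OF R(1)] bop_apply_mult)
  qed
  from this[OF T] this[OF T'] have "R * (T * R) = T * R" "adj (R * (adj T * R)) = adj (adj T * R)"
    by simp_all
  then show ?thesis
    by (simp add: adj_mult R mult.assoc)
qed

text \<open>The meet is the orthogonal projection onto the intersection of the ranges. It lies in the
  algebra by the double commutant property: an operator that commutes with every projection of
  the family preserves each range, hence the intersection, and the same is true of its adjoint. The
  greatest lower bound property is stated for an arbitrary operator \<open>B\<close>, since daseinisation
  approximates projections that are not in \<open>V\<close>.\<close>

lemma proj_Meet_is_meet:
  assumes V: "von_neumann_algebra V" and X: "X \<subseteq> projections V"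
  shows "proj_Meet V X \<in> projections V"
    and "Q \<in> X \<Longrightarrow> proj_le (proj_Meet V X) Q"
    and "(\<And>Q. Q \<in> X \<Longrightarrow> proj_le B Q) \<Longrightarrow> proj_le B (proj_Meet V X)"
proof -
  define K where "K = (\<Inter>Q\<in>X. range (bop_apply Q))"
  have Xi: "Q * Q = Q" if "Q \<in> X" for Q
    using that X projectionsD by blast
  have "closed_csubspace (range (bop_apply Q))" if "Q \<in> X" for Q
    using Xi[OF that] by (rule closed_csubspace_range_idempotent)
  then have "closed_csubspace K"
    unfolding K_def by (rule closed_csubspace_INT)
  then obtain R where R: "R * R = R" "adj R = R" "range (bop_apply R) = K"
    using orthogonal_projection_exists by blast
  have invariant: "bop_apply T x \<in> K" if T: "T \<in> commutant V" and x: "x \<in> K" for T x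
  proof -
    have "bop_apply T x \<in> range (bop_apply Q)" if Q: "Q \<in> X" for Q
    proof -
      have "Q \<in> V"
        using X Q projectionsD(1) by blast
      then have "bop_apply (T * Q) x = bop_apply (Q * T) x"
        using T by (simp add: commutant_def)
      moreover have "bop_apply Q x = x"
        using x Q range_idempotent[OF Xi[OF Q]] by (auto simp: K_def)
      ultimately show ?thesis
        by (simp add: range_idempotent[OF Xi[OF Q]] bop_apply_mult)
    qed
    then show ?thesis
      by (simp add: K_def)
  qed
  have "R * T = T * R" if "T \<in> commutant V" for T
    using R invariant that commutant_adj[OF von_neumann_algebra_closed(2)[OF V]]
    by (intro projection_commutes_if_range_invariant) auto
  then have "R \<in> commutant (commutant V)"
    by (simp add: commutant_def)
  then have RV: "R \<in> projections V"
    using V R by (simp add: von_neumann_algebra_def projections_def)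
  have lower: "proj_le R Q" if "Q \<in> X" for Q
    using that by (auto simp: proj_le_def R K_def)
  have greatest: "proj_le B R" if "\<And>Q. Q \<in> X \<Longrightarrow> proj_le B Q" for B
    using that by (auto simp: proj_le_def R K_def)
  have "proj_Meet V X = R"
    using RV lower greatest by (intro proj_Meet_eqI) auto
  with RV lower greatest show "proj_Meet V X \<in> projections V"
    and "Q \<in> X \<Longrightarrow> proj_le (proj_Meet V X) Q"
    and "(\<And>Q. Q \<in> X \<Longrightarrow> proj_le B Q) \<Longrightarrow> proj_le B (proj_Meet V X)"
    by auto
qed


section \<open>Conjugation by a unitary\<close>

lemma unitary_adj: "unitary (adj U) \<longleftrightarrow> unitary U"
  by (auto simp: unitary_def)

lemma conjugation_adj_conjugation:
  assumes "unitary U"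
  shows "conjugation (adj U) (conjugation U A) = A"
proof -
  have "conjugation (adj U) (conjugation U A) = (adj U * U) * A * (adj U * U)"
    by (simp add: conjugation_def mult.assoc)
  then show ?thesis
    using assms by (simp add: unitary_def)
qed

lemma conjugation_conjugation_adj:
  assumes "unitary U"
  shows "conjugation U (conjugation (adj U) A) = A"
  using conjugation_adj_conjugation[of "adj U" A] assms by (simp add: unitary_adj)

lemma image_conjugation_adj:
  assumes "unitary U"
  shows "conjugation (adj U) ` conjugation U ` V = V"
    and "conjugation U ` conjugation (adj U) ` V = V"
  by (simp_all add: image_image conjugation_adj_conjugation conjugation_conjugation_adj assms)

lemma conjugation_image_eq:
  assumes "unitary U"
  shows "conjugation U ` S = {A. conjugation (adj U) A \<in> S}"
  using conjugation_adj_conjugation[OF assms] conjugation_conjugation_adj[OF assms]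
  by (auto simp: image_iff) metis

lemma conjugation_one:
  assumes "unitary U"
  shows "conjugation U 1 = 1"
  using assms by (simp add: conjugation_def unitary_def)

lemma conjugation_add: "conjugation U (A + B) = conjugation U A + conjugation U B"
  by (simp add: conjugation_def algebra_simps)

lemma conjugation_scaleC: "conjugation U (c *\<^sub>C A) = c *\<^sub>C conjugation U A"
  by (simp add: conjugation_def scaleC_mult_bop mult_scaleC_bop)

lemma conjugation_mult:
  assumes "unitary U"
  shows "conjugation U (A * B) = conjugation U A * conjugation U B"
proof -
  have "conjugation U A * conjugation U B = U * A * (adj U * U) * B * adj U"
    by (simp add: conjugation_def mult.assoc)
  also have "\<dots> = U * A * B * adj U"
    using assms by (simp add: unitary_def)
  finally show ?thesis
    by (simp add: conjugation_def mult.assoc)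
qed

lemma conjugation_adjoint: "adj (conjugation U A) = conjugation U (adj A)"
  by (simp add: conjugation_def adj_mult mult.assoc)

lemma conjugation_eq_iff:
  assumes "unitary U"
  shows "conjugation U A = conjugation U B \<longleftrightarrow> A = B"
  using conjugation_adj_conjugation[OF assms] by metis

text \<open>\<open>T\<close> commutes with \<open>U A U\<^sup>*\<close> exactly when \<open>U\<^sup>* T U\<close> commutes with \<open>A\<close>.\<close>

lemma commutant_conjugation:
  assumes U: "unitary U"
  shows "commutant (conjugation U ` S) = conjugation U ` commutant S"
proof -
  have "T * conjugation U A = conjugation U A * T
      \<longleftrightarrow> conjugation (adj U) T * A = A * conjugation (adj U) T" for T A
  proof -
    have "T * conjugation U A = conjugation U (conjugation (adj U) T * A)"
      "conjugation U A * T = conjugation U (A * conjugation (adj U) T)"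
      by (simp_all add: conjugation_mult U conjugation_conjugation_adj)
    then show ?thesis
      by (simp add: conjugation_eq_iff U)
  qed
  then show ?thesis
    unfolding conjugation_image_eq[OF U, of "commutant S"] by (simp add: commutant_def)
qed

lemma von_neumann_algebra_conjugation:
  assumes "unitary U" "von_neumann_algebra V"
  shows "von_neumann_algebra (conjugation U ` V)"
  using assms
  by (auto simp: von_neumann_algebra_def commutant_conjugation conjugation_adjoint)

lemma conjugation_in_algebra:
  assumes "von_neumann_algebra N" "U \<in> N" "A \<in> N"
  shows "conjugation U A \<in> N"
  using assms by (simp add: conjugation_def von_neumann_algebra_closed)

lemma contexts_conjugation:
  assumes N: "von_neumann_algebra N" "U \<in> N" and U: "unitary U" and V: "V \<in> contexts N"
  shows "conjugation U ` V \<in> contexts N"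
proof -
  have "von_neumann_algebra V" "abelian V" "V \<subseteq> N" and nt: "V \<noteq> range (\<lambda>c. c *\<^sub>C 1)"
    using V by (auto simp: contexts_def)
  then have "von_neumann_algebra (conjugation U ` V)" "conjugation U ` V \<subseteq> N"
    using N U by (auto intro: von_neumann_algebra_conjugation conjugation_in_algebra)
  moreover have "abelian (conjugation U ` V)"
    using \<open>abelian V\<close> by (simp add: abelian_def conjugation_mult[OF U, symmetric])
  moreover have "conjugation U ` V \<noteq> range (\<lambda>c. c *\<^sub>C 1)"
  proof
    assume "conjugation U ` V = range (\<lambda>c. c *\<^sub>C 1)"
    then have "conjugation (adj U) ` conjugation U ` V
        = conjugation (adj U) ` range (\<lambda>c. c *\<^sub>C 1)"
      by simp
    then have "V = conjugation (adj U) ` range (\<lambda>c. c *\<^sub>C 1)"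
      by (simp only: image_conjugation_adj[OF U])
    then show False
      using nt U by (simp add: image_image conjugation_scaleC conjugation_one unitary_adj)
  qed
  ultimately show ?thesis
    by (simp add: contexts_def)
qed

lemma projections_conjugation:
  assumes U: "unitary U"
  shows "projections (conjugation U ` V) = conjugation U ` projections V"
  by (auto simp: projections_def conjugation_adjoint conjugation_mult[OF U, symmetric]
      conjugation_eq_iff[OF U])

text \<open>Since \<open>U\<^sup>*\<close> is onto, the range of \<open>U P U\<^sup>*\<close> is the image under \<open>U\<close> of the range of \<open>P\<close>.\<close>

lemma proj_le_conjugation:
  assumes U: "unitary U"
  shows "proj_le (conjugation U P) (conjugation U Q) \<longleftrightarrow> proj_le P Q"
proof -
  have "bop_apply (adj U) (bop_apply U x) = x" "bop_apply U (bop_apply (adj U) x) = x" for x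
    using U by (simp_all add: unitary_def bop_apply_mult[symmetric] bop_apply_one)
  then have inj: "inj (bop_apply U)" and surj: "surj (bop_apply (adj U))"
    by (metis injI, metis surjI)
  have "range (bop_apply (conjugation U A)) = bop_apply U ` range (bop_apply A)" for A
  proof -
    have "bop_apply (conjugation U A) = (\<lambda>x. bop_apply U (bop_apply A x)) \<circ> bop_apply (adj U)"
      by (simp add: fun_eq_iff conjugation_def bop_apply_mult)
    then have "range (bop_apply (conjugation U A)) = (\<lambda>x. bop_apply U (bop_apply A x)) ` UNIV"
      using surj by (simp only: image_comp[symmetric])
    then show ?thesis
      by (simp add: image_image)
  qed
  then show ?thesis
    by (simp add: proj_le_def inj_image_subset_iff[OF inj])
qed

lemma proj_Meet_conjugation:
  assumes U: "unitary U" and V: "von_neumann_algebra V" and X: "X \<subseteq> projections V"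
  shows "proj_Meet (conjugation U ` V) (conjugation U ` X) = conjugation U (proj_Meet V X)"
  using proj_Meet_is_meet[OF V X]
  by (intro proj_Meet_eqI) (auto simp: projections_conjugation[OF U] proj_le_conjugation[OF U])

lemma outer_dasein_at_conjugation:
  assumes U: "unitary U" and V: "von_neumann_algebra V"
  shows "outer_dasein_at (conjugation U ` V) P
    = conjugation U (outer_dasein_at V (conjugation (adj U) P))"
proof -
  have "proj_le P (conjugation U Q) \<longleftrightarrow> proj_le (conjugation (adj U) P) Q" for Q
    using proj_le_conjugation[OF U, of "conjugation (adj U) P" Q]
    by (simp add: conjugation_conjugation_adj[OF U])
  then have "{Q \<in> projections (conjugation U ` V). proj_le P Q}
      = conjugation U ` {Q \<in> projections V. proj_le (conjugation (adj U) P) Q}"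
    by (auto simp: projections_conjugation[OF U])
  then show ?thesis
    unfolding outer_dasein_at_def by (simp add: proj_Meet_conjugation[OF U V])
qed


section \<open>The action on spectra and clopen subobjects\<close>

lemma characters_apply:
  assumes "l \<in> characters V"
  shows "A \<in> V \<Longrightarrow> B \<in> V \<Longrightarrow> l (A + B) = l A + l B"
    and "A \<in> V \<Longrightarrow> l (c *\<^sub>C A) = c * l A"
    and "A \<in> V \<Longrightarrow> B \<in> V \<Longrightarrow> l (A * B) = l A * l B"
  using assms by (auto simp: characters_def)

lemma characters_one:
  assumes "l \<in> characters V" "1 \<in> V"
  shows "l 1 = 1"
proof -
  obtain A where A: "A \<in> V" "l A \<noteq> 0"
    using assms by (auto simp: characters_def)
  then have "l A = l A * l 1"
    using characters_apply(3)[OF assms(1) A(1) assms(2)] by simp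
  with A show ?thesis
    by simp
qed

lemma charactersI:
  assumes "l \<in> extensional V" "1 \<in> V" "l 1 = 1"
    and "\<And>A B. A \<in> V \<Longrightarrow> B \<in> V \<Longrightarrow> l (A + B) = l A + l B"
    and "\<And>c A. A \<in> V \<Longrightarrow> l (c *\<^sub>C A) = c * l A"
    and "\<And>A B. A \<in> V \<Longrightarrow> B \<in> V \<Longrightarrow> l (A * B) = l A * l B"
  shows "l \<in> characters V"
  using assms unfolding characters_def by (auto intro!: bexI[of _ 1])

lemma topspace_gelfand_spectrum: "topspace (gelfand_spectrum V) = characters V"
  by (auto simp: gelfand_spectrum_def characters_def PiE_def)

lemma continuous_map_eval:
  assumes "A \<in> V"
  shows "continuous_map (gelfand_spectrum V) euclidean (\<lambda>l. l A)"
  unfolding gelfand_spectrum_def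
  using assms by (intro continuous_map_from_subtopology continuous_map_product_projection)

lemma restrict_character:
  assumes "l \<in> characters V" "V' \<subseteq> V" "von_neumann_algebra V'"
  shows "restrict l V' \<in> characters V'"
proof -
  note closed = von_neumann_algebra_closed[OF assms(3)]
  have "l 1 = 1"
    using assms closed(1) characters_one by blast
  then show ?thesis
    using assms closed characters_apply[OF assms(1)]
    by (intro charactersI) (auto simp: subset_iff)
qed

abbreviation pull_back where
  "pull_back U V l \<equiv> restrict (l \<circ> conjugation U) V"

lemma pull_back_character:
  assumes U: "unitary U" and V: "von_neumann_algebra V" and l: "l \<in> characters (conjugation U ` V)"
  shows "pull_back U V l \<in> characters V"
proof -
  note closed = von_neumann_algebra_closed[OF V]
  have "l 1 = 1"
    using characters_one[OF l] image_eqI[of 1 "conjugation U" 1, OF _ closed(1)]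
    by (simp add: conjugation_one[OF U])
  then show ?thesis
    using closed characters_apply[OF l]
    by (intro charactersI) (auto simp: conjugation_one[OF U] conjugation_add conjugation_scaleC
        conjugation_mult[OF U])
qed

lemma pull_back_pull_back:
  assumes U: "unitary U" and l: "l \<in> extensional V"
  shows "pull_back U V (pull_back (adj U) (conjugation U ` V) l) = l"
  using l by (auto simp: fun_eq_iff conjugation_adj_conjugation[OF U] extensional_def)

lemma continuous_map_pull_back:
  assumes U: "unitary U" and V: "von_neumann_algebra V"
  shows "continuous_map (gelfand_spectrum (conjugation U ` V)) (gelfand_spectrum V) (pull_back U V)"
proof -
  have "continuous_map (gelfand_spectrum (conjugation U ` V)) euclidean (\<lambda>l. pull_back U V l A)"
    if "A \<in> V" for A
    using continuous_map_eval[of "conjugation U A" "conjugation U ` V"] that by simp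
  then have "continuous_map (gelfand_spectrum (conjugation U ` V))
      (product_topology (\<lambda>_. euclidean) V) (pull_back U V)"
    by (auto simp: continuous_map_componentwise)
  then show ?thesis
    using pull_back_character[OF U V]
    by (simp add: gelfand_spectrum_def[of V] continuous_map_in_subtopology
        topspace_gelfand_spectrum image_subset_iff Pi_iff)
qed

text \<open>The topology is that of pointwise convergence, and evaluating a pull-back at \<open>A\<close> means
  evaluating the original at \<open>U A U\<^sup>*\<close>. So pull-backs are continuous, and pulling back along
  \<open>U\<^sup>*\<close> is the continuous inverse.\<close>

lemma homeomorphic_map_pull_back:
  assumes U: "unitary U" and V: "von_neumann_algebra V"
  shows "homeomorphic_map (gelfand_spectrum (conjugation U ` V)) (gelfand_spectrum V) (pull_back U V)"
proof -
  have U': "unitary (adj U)"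
    using U by (simp add: unitary_adj)
  have "continuous_map (gelfand_spectrum V) (gelfand_spectrum (conjugation U ` V))
      (pull_back (adj U) (conjugation U ` V))"
    using continuous_map_pull_back[OF U' von_neumann_algebra_conjugation[OF U V]]
    by (simp only: image_conjugation_adj[OF U])
  moreover have "pull_back (adj U) (conjugation U ` V) (pull_back U V l) = l"
    if "l \<in> characters (conjugation U ` V)" for l
    using pull_back_pull_back[OF U', of l "conjugation U ` V"] that
    by (simp only: image_conjugation_adj[OF U] adj_adj characters_def mem_Collect_eq)
  moreover have "pull_back U V (pull_back (adj U) (conjugation U ` V) l) = l"
    if "l \<in> characters V" for l
    using that by (intro pull_back_pull_back[OF U]) (simp add: characters_def)
  ultimately have "homeomorphic_maps (gelfand_spectrum (conjugation U ` V)) (gelfand_spectrum V)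
      (pull_back U V) (pull_back (adj U) (conjugation U ` V))"
    using continuous_map_pull_back[OF U V]
    by (simp only: homeomorphic_maps_def topspace_gelfand_spectrum) blast
  then show ?thesis
    by (rule homeomorphic_maps_map[THEN iffD1, THEN conjunct1])
qed

lemma clopen_subobjectsD:
  assumes "S \<in> clopen_subobjects N" "V \<in> contexts N"
  shows "openin (gelfand_spectrum V) (S V)" "closedin (gelfand_spectrum V) (S V)"
    and "S V \<subseteq> characters V"
    and "V' \<in> contexts N \<Longrightarrow> V' \<subseteq> V \<Longrightarrow> l \<in> S V \<Longrightarrow> restrict l V' \<in> S V'"
proof -
  show op: "openin (gelfand_spectrum V) (S V)" and "closedin (gelfand_spectrum V) (S V)"
    using assms by (simp_all add: clopen_subobjects_def)
  show "S V \<subseteq> characters V"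
    using openin_subset[OF op] by (simp only: topspace_gelfand_spectrum)
  show "V' \<in> contexts N \<Longrightarrow> V' \<subseteq> V \<Longrightarrow> l \<in> S V \<Longrightarrow> restrict l V' \<in> S V'"
    using assms unfolding clopen_subobjects_def by blast
qed

lemma subobject_map_apply:
  assumes "S \<in> clopen_subobjects N" "V \<in> contexts N"
  shows "subobject_map N U S V = pull_back U V ` S (conjugation U ` V)"
  using assms by (simp add: subobject_map_def)

lemma subobject_map_closed:
  assumes N: "von_neumann_algebra N" "U \<in> N" and U: "unitary U" and S: "S \<in> clopen_subobjects N"
  shows "subobject_map N U S \<in> clopen_subobjects N"
proof -
  have app: "subobject_map N U S V = pull_back U V ` S (conjugation U ` V)"
    if "V \<in> contexts N" for V
    using S that by (rule subobject_map_apply)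
  have ctx: "conjugation U ` V \<in> contexts N" "von_neumann_algebra V" if "V \<in> contexts N" for V
    using that contexts_conjugation[OF N U that] by (auto simp: contexts_def)
  have "openin (gelfand_spectrum V) (subobject_map N U S V)
      \<and> closedin (gelfand_spectrum V) (subobject_map N U S V)" if V: "V \<in> contexts N" for V
    unfolding app[OF V]
    using homeomorphic_map_pull_back[OF U ctx(2)[OF V]] clopen_subobjectsD[OF S ctx(1)[OF V]]
    by (meson homeomorphic_imp_open_map homeomorphic_imp_closed_map open_map_def closed_map_def)
  moreover have "restrict l V' \<in> subobject_map N U S V'"
    if V: "V \<in> contexts N" "V' \<in> contexts N" "V' \<subseteq> V" and l: "l \<in> subobject_map N U S V" for V V' l
  proof -
    obtain m where m: "m \<in> S (conjugation U ` V)" "l = pull_back U V m"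
      using l app[OF V(1)] by auto
    have "restrict m (conjugation U ` V') \<in> S (conjugation U ` V')"
      using clopen_subobjectsD(4)[OF S ctx(1) ctx(1) _ m(1)] V by blast
    moreover have "restrict l V' = pull_back U V' (restrict m (conjugation U ` V'))"
      using V(3) by (auto simp: m(2) fun_eq_iff)
    ultimately show ?thesis
      by (simp add: app[OF V(2)])
  qed
  moreover have "subobject_map N U S \<in> extensional (contexts N)"
    using S by (simp add: subobject_map_def)
  ultimately show ?thesis
    by (auto simp: clopen_subobjects_def)
qed

lemma subobject_map_inverse:
  assumes N: "von_neumann_algebra N" "U \<in> N" and U: "unitary U" and S: "S \<in> clopen_subobjects N"
  shows "subobject_map N U (subobject_map N (adj U) S) = S"
proof
  fix V
  have U': "unitary (adj U)" "adj U \<in> N"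
    using U N by (simp_all add: unitary_adj von_neumann_algebra_closed)
  have S': "subobject_map N (adj U) S \<in> clopen_subobjects N"
    using subobject_map_closed[OF N(1) U'(2,1) S] .
  show "subobject_map N U (subobject_map N (adj U) S) V = S V"
  proof (cases "V \<in> contexts N")
    case False
    have "S \<in> extensional (contexts N)"
      "subobject_map N U (subobject_map N (adj U) S) \<in> extensional (contexts N)"
      using S subobject_map_closed[OF N U S'] by (simp_all add: clopen_subobjects_def)
    from this[THEN extensional_arb, OF False] show ?thesis
      by simp
  next
    case V: True
    have "subobject_map N U (subobject_map N (adj U) S) V
        = pull_back U V ` pull_back (adj U) (conjugation U ` V)
            ` S (conjugation (adj U) ` conjugation U ` V)"
      by (simp only: subobject_map_apply[OF S' V]
          subobject_map_apply[OF S contexts_conjugation[OF N U V]])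
    also have "\<dots> = (\<lambda>l. pull_back U V (pull_back (adj U) (conjugation U ` V) l)) ` S V"
      unfolding image_conjugation_adj[OF U] by (rule image_image)
    also have "\<dots> = (\<lambda>l. l) ` S V"
      using clopen_subobjectsD(3)[OF S V]
      by (intro image_cong refl pull_back_pull_back[OF U]) (auto simp: characters_def)
    finally show ?thesis
      by simp
  qed
qed

text \<open>Applied to \<open>U\<close> and to \<open>U\<^sup>*\<close>, \<open>subobject_map_inverse\<close> gives both a left and a right
  inverse on clopen subobjects. The left inverse yields the injectivity without which the
  inverse function would be meaningless.\<close>

lemma inverse_subobject_map:
  assumes N: "von_neumann_algebra N" "U \<in> N" and U: "unitary U" and S: "S \<in> clopen_subobjects N"
  shows "the_inv_into (clopen_subobjects N) (subobject_map N (adj U)) S = subobject_map N U S"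
proof (rule the_inv_into_f_eq)
  show "inj_on (subobject_map N (adj U)) (clopen_subobjects N)"
    by (rule inj_on_inverseI[where g = "subobject_map N U"]) (rule subobject_map_inverse[OF N U])
  show "subobject_map N (adj U) (subobject_map N U S) = S"
    using subobject_map_inverse[of N "adj U" S] N U S
    by (simp add: unitary_adj von_neumann_algebra_closed)
  show "subobject_map N U S \<in> clopen_subobjects N"
    using subobject_map_closed[OF N U S] .
qed


section \<open>Outer daseinisation\<close>

lemma outer_daseinisation_apply:
  assumes "V \<in> contexts N"
  shows "outer_daseinisation N P V = {l \<in> characters V. l (outer_dasein_at V P) = 1}"
  using assms by (simp add: outer_daseinisation_def topspace_gelfand_spectrum)

lemma outer_dasein_at_projection:
  assumes "von_neumann_algebra V"
  shows "outer_dasein_at V P \<in> projections V"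
  unfolding outer_dasein_at_def by (rule proj_Meet_is_meet(1)[OF assms]) auto

lemma proj_le_outer_dasein_at:
  assumes V: "von_neumann_algebra V"
  shows "proj_le P (outer_dasein_at V P)"
  unfolding outer_dasein_at_def by (rule proj_Meet_is_meet(3)[OF assms]) auto

text \<open>A character takes only the values 0 and 1 on a projection, so its value being 1 is both
  an open and a closed condition. The presheaf condition holds because a smaller context offers
  fewer projections above \<open>P\<close>, so that the meet can only grow.\<close>

lemma outer_daseinisation_clopen: "outer_daseinisation N P \<in> clopen_subobjects N"
proof -
  define D where "D V = outer_dasein_at V P" for V
  have vn: "von_neumann_algebra V" if "V \<in> contexts N" for V
    using that by (simp add: contexts_def)
  have D: "D V \<in> projections V" if "V \<in> contexts N" for V
    unfolding D_def using vn[OF that] by (rule outer_dasein_at_projection)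
  have app: "outer_daseinisation N P V = {l \<in> characters V. l (D V) = 1}" if "V \<in> contexts N" for V
    using that by (simp add: outer_daseinisation_apply D_def)
  have "openin (gelfand_spectrum V) (outer_daseinisation N P V)
      \<and> closedin (gelfand_spectrum V) (outer_daseinisation N P V)" if V: "V \<in> contexts N" for V
  proof
    note DV = projectionsD[OF D[OF V]]
    have cont: "continuous_map (gelfand_spectrum V) euclidean (\<lambda>l. l (D V))"
      using DV(1) by (rule continuous_map_eval)
    have "l (D V) = 1 \<longleftrightarrow> l (D V) \<in> - {0}" if "l \<in> characters V" for l
      using characters_apply(3)[OF that DV(1) DV(1)] by (auto simp: DV(2))
    then have "outer_daseinisation N P V
        = {l \<in> topspace (gelfand_spectrum V). l (D V) \<in> - {0}}"
      by (auto simp: app[OF V] topspace_gelfand_spectrum)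
    then show "openin (gelfand_spectrum V) (outer_daseinisation N P V)"
      using openin_continuous_map_preimage[OF cont, of "- {0}"] by (simp add: open_Compl)
    have "outer_daseinisation N P V = {l \<in> topspace (gelfand_spectrum V). l (D V) \<in> {1}}"
      by (simp add: app[OF V] topspace_gelfand_spectrum)
    then show "closedin (gelfand_spectrum V) (outer_daseinisation N P V)"
      using closedin_continuous_map_preimage[OF cont, of "{1}"] by simp
  qed
  moreover have "restrict l V' \<in> outer_daseinisation N P V'"
    if V: "V \<in> contexts N" "V' \<in> contexts N" "V' \<subseteq> V" and l: "l \<in> outer_daseinisation N P V"
    for V V' l
  proof -
    note D' = projectionsD[OF D[OF V(2)]]
    have l1: "l \<in> characters V" "l (D V) = 1"
      using l by (auto simp: app[OF V(1)])
    have "D V' \<in> {Q \<in> projections V. proj_le P Q}"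
      using V(3) D' proj_le_outer_dasein_at[OF vn[OF V(2)], of P]
      by (auto simp: projections_def D_def[of V'])
    then have "proj_le (D V) (D V')"
      unfolding D_def[of V] outer_dasein_at_def
      by (intro proj_Meet_is_meet(2)[OF vn[OF V(1)]]) auto
    then have "l (D V' * D V) = l (D V)"
      using D'(2) by (simp add: proj_le_iff_mult)
    then have "l (D V') = 1"
      using characters_apply(3)[OF l1(1), of "D V'" "D V"] l1(2) V(3) D'(1)
        projectionsD(1)[OF D[OF V(1)]] by auto
    then show ?thesis
      using restrict_character[OF l1(1) V(3) vn[OF V(2)]] D'(1) by (simp add: app[OF V(2)])
  qed
  ultimately show ?thesis
    by (auto simp: clopen_subobjects_def outer_daseinisation_def)
qed

text \<open>At \<open>V\<close> the left-hand side pulls back the characters of \<open>U V U\<^sup>*\<close> that are 1 on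
  \<open>U D U\<^sup>*\<close>, with \<open>D\<close> the approximation of \<open>U\<^sup>* P U\<close> in \<open>V\<close>. Their pull-backs are 1 on \<open>D\<close>, and
  every such character of \<open>V\<close> arises in this way because the pull-back is onto.\<close>

lemma subobject_map_outer_daseinisation:
  assumes N: "von_neumann_algebra N" "U \<in> N" and U: "unitary U"
  shows "subobject_map N U (outer_daseinisation N P)
    = outer_daseinisation N (conjugation (adj U) P)"
proof
  fix V
  show "subobject_map N U (outer_daseinisation N P) V
    = outer_daseinisation N (conjugation (adj U) P) V"
  proof (cases "V \<in> contexts N")
    case False
    have "subobject_map N U (outer_daseinisation N P) \<in> extensional (contexts N)"
      "outer_daseinisation N (conjugation (adj U) P) \<in> extensional (contexts N)"
      using subobject_map_closed[OF N U outer_daseinisation_clopen]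
        outer_daseinisation_clopen[of N] by (simp_all add: clopen_subobjects_def)
    from this[THEN extensional_arb, OF False] show ?thesis
      by simp
  next
    case V: True
    have vn: "von_neumann_algebra V"
      using V by (simp add: contexts_def)
    define D where "D = outer_dasein_at V (conjugation (adj U) P)"
    have D: "D \<in> V"
      unfolding D_def using outer_dasein_at_projection[OF vn] projectionsD(1) by blast
    have surj: "pull_back U V ` characters (conjugation U ` V) = characters V"
      using homeomorphic_imp_surjective_map[OF homeomorphic_map_pull_back[OF U vn]]
      by (simp only: topspace_gelfand_spectrum)
    have "subobject_map N U (outer_daseinisation N P) V
        = pull_back U V ` {l \<in> characters (conjugation U ` V). l (conjugation U D) = 1}"
      using V outer_daseinisation_clopen[of N P]
      by (simp add: subobject_map_def outer_daseinisation_apply contexts_conjugation[OF N U]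
          outer_dasein_at_conjugation[OF U vn] D_def)
    also have "\<dots> = {m \<in> pull_back U V ` characters (conjugation U ` V). m D = 1}"
      using D by auto
    also have "\<dots> = outer_daseinisation N (conjugation (adj U) P) V"
      unfolding surj D_def by (simp only: outer_daseinisation_apply[OF V])
    finally show ?thesis .
  qed
qed

theorem proposition4p8:
  fixes N :: "'h::complex_hilbert_space bop set"
    and H :: "'h \<rightharpoonup> 'h"
    and U :: "real \<Rightarrow> 'h bop"
    and F_inv :: "real \<Rightarrow> ('h bop set \<Rightarrow> ('h bop \<Rightarrow> complex) set) \<Rightarrow>
                    ('h bop set \<Rightarrow> ('h bop \<Rightarrow> complex) set)"
    and P\<^sub>0 :: "'h bop"
    and P :: "real \<Rightarrow> 'h bop"
  assumes "von_neumann_algebra N"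
    and "\<not> has_type_I2_summand N"
    and "selfadjoint H"
    and "affiliated H N"
    and "one_parameter_unitary_group N (\<lambda>t. U (- t))"
    and "\<And>t. U (- t) = functional_calculus (\<lambda>r. exp (- (\<i> * of_real t * of_real r))) H"
    and "\<And>t. F_inv t = restrict
           (the_inv_into (clopen_subobjects N) (subobject_map N (U (- t)))) (clopen_subobjects N)"
    and "P\<^sub>0 \<in> projections N"
    and "\<And>t. P t = U (- t) * P\<^sub>0 * U t"
  shows "\<forall>t. F_inv t = subobject_map N (U t) \<and>
             F_inv t (outer_daseinisation N P\<^sub>0) = outer_daseinisation N (P t)"
proof
  fix t
  have group: "\<And>t. U (- t) \<in> N \<and> unitary (U (- t))" "U 0 = 1"
    "\<And>s t. U (- (s + t)) = U (- s) * U (- t)"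
    using assms(5) by (auto simp: one_parameter_unitary_group_def)
  from group(1)[of "- t"] have U: "U t \<in> N" "unitary (U t)"
    by simp_all
  have "U (- t) * U t = 1"
    using group(3)[of t "- t"] group(2) by simp
  then have "U (- t) * (U t * adj (U t)) = adj (U t)"
    by (simp add: mult.assoc[symmetric])
  then have adj_U: "U (- t) = adj (U t)"
    using U(2) by (simp add: unitary_def)
  have F: "F_inv t = subobject_map N (U t)"
  proof
    fix S
    show "F_inv t S = subobject_map N (U t) S"
    proof (cases "S \<in> clopen_subobjects N")
      case True
      then show ?thesis
        using inverse_subobject_map[OF assms(1) U True] by (simp add: assms(7) adj_U)
    qed (simp add: assms(7) subobject_map_def)
  qed
  moreover have "P t = conjugation (adj (U t)) P\<^sub>0"
    by (simp add: assms(9) adj_U conjugation_def)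
  ultimately show "F_inv t = subobject_map N (U t) \<and>
      F_inv t (outer_daseinisation N P\<^sub>0) = outer_daseinisation N (P t)"
    using subobject_map_outer_daseinisation[OF assms(1) U] by simp
qed

end
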